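(* Let $g:\mathbb{N}\to\mathbb{Z}$ be an arithmetic function with $g(1)=1$, and assume $g(3)\equiv 0$ or $g(3)\equiv 1 \pmod{3}$. Define polynomials $P_n^g(x)$ by $P_0^g(x)=1$ and, for $n\ge 1$, $$P_n^g(x)=\frac{x}{n}\sum_{k=1}^{n} g(k)\,P_{n-k}^g(x).$$ Let $m\ge 3$ and let $\zeta_m$ be a primitive $m$th root of unity. Then $P_n^g(\zeta_m)\neq 0$ for all $n\in\mathbb{N}$. In particular, $P_n^g(\pm i)\neq 0$ for all $n\in\mathbb{N}$.
   Context: An arithmetic function $g:\mathbb{N}\to\mathbb{Z}$ is called normalized if $g(1)=1$. The polynomials $P_n^g$ generalize the D'Arcais polynomials (the case $g=\sigma$, the sum-of-divisors function). *)

theory Defs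
  imports Complex_Main "HOL-Computational_Algebra.Polynomial" "HOL-Number_Theory.Cong"
begin

(* The value g 0 is never used, so a function on nat represents an arithmetic function
   on the positive integers. *)
fun P_poly :: "(nat \<Rightarrow> int) \<Rightarrow> nat \<Rightarrow> 'a::field_char_0 poly" where
  "P_poly g 0 = 1"
| "P_poly g (Suc n) =
     smult (1 / of_nat (Suc n))
       ([:0, 1:] * (\<Sum>k=1..Suc n. smult (of_int (g k)) (P_poly g (Suc n - k))))"

definition primitive_root_of_unity :: "nat \<Rightarrow> 'a::field \<Rightarrow> bool" where
  "primitive_root_of_unity m z \<longleftrightarrow>
     m > 0 \<and> z ^ m = 1 \<and> (\<forall>k. 0 < k \<and> k < m \<longrightarrow> z ^ k \<noteq> 1)"

end

theory Submission
  imports Defs "HOL-Computational_Algebra.Polynomial_Factorial"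
begin

text \<open>The numbers \<open>a n = n! P\<^sub>n(\<zeta>)\<close> lie in \<open>\<int>[\<zeta>]\<close> and satisfy
  \<open>a (p l + r) \<equiv> a p ^ l * a r\<close> modulo \<open>p\<close>. It suffices to choose \<open>p\<close> so that
  \<open>a 0, \<dots>, a p\<close> are units modulo \<open>p\<close>, because \<open>1 / p\<close> is not in \<open>\<int>[\<zeta>]\<close> and so 0 is not such a unit.
  If \<open>m\<close> is not a power of 2, then \<open>1 - \<zeta>\<close> divides an odd integer and \<open>p = 2\<close> works, as
  \<open>a 2 = \<zeta> (\<zeta> + g 2)\<close>. If \<open>m \<ge> 4\<close> is a power of 2, then \<open>1 - \<zeta>\<close> and \<open>1 + \<zeta>\<close> divide 2
  and \<open>p = 3\<close> works, as \<open>a 3 \<equiv> \<zeta> (\<zeta>\<^sup>2 - g 3)\<close>; this is where the condition on \<open>g 3\<close> enters.\<close>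

section \<open>The ring Z[z] of values of integer polynomials at z\<close>

definition int_eval :: "'a::field_char_0 \<Rightarrow> int poly \<Rightarrow> 'a" where
  "int_eval z p = poly (map_poly of_int p) z"

lemma int_eval_add: "int_eval z (p + q) = int_eval z p + int_eval z q"
proof -
  have "map_poly of_int (p + q) = map_poly of_int p + (map_poly of_int q :: 'a poly)"
    by (rule poly_eqI) (simp add: coeff_map_poly)
  then show ?thesis by (simp add: int_eval_def)
qed

lemma int_eval_mult: "int_eval z (p * q) = int_eval z p * int_eval z q"
proof -
  have "map_poly of_int (p * q) = map_poly of_int p * (map_poly of_int q :: 'a poly)"
    by (rule poly_eqI) (simp add: coeff_map_poly coeff_mult)
  then show ?thesis by (simp add: int_eval_def)
qed

lemma int_eval_const [simp]: "int_eval z [:c:] = of_int c"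
  by (simp add: int_eval_def map_poly_pCons)

lemma int_eval_X [simp]: "int_eval z [:0, 1:] = z"
  by (simp add: int_eval_def map_poly_pCons)

lemma int_eval_smult: "int_eval z (smult c p) = of_int c * int_eval z p"
  using int_eval_mult[of z "[:c:]" p] by simp

lemma int_eval_diff: "int_eval z (p - q) = int_eval z p - int_eval z q"
  using int_eval_add[of z "p - q" q] by simp

lemma int_eval_monom [simp]: "int_eval z (monom c n) = of_int c * z ^ n"
  by (simp add: int_eval_def map_poly_monom poly_monom)

definition int_adjoin :: "'a::field_char_0 \<Rightarrow> 'a set" where
  "int_adjoin z = range (int_eval z)"

lemma int_adjoin_of_int [simp]: "of_int c \<in> int_adjoin z"
  unfolding int_adjoin_def by (metis int_eval_const rangeI)

lemma int_adjoin_generator [simp]: "z \<in> int_adjoin z"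
  unfolding int_adjoin_def by (metis int_eval_X rangeI)

lemma int_adjoin_numeral [simp]:
  "0 \<in> int_adjoin z" "1 \<in> int_adjoin z" "numeral k \<in> int_adjoin z"
  using int_adjoin_of_int[of 0 z] int_adjoin_of_int[of 1 z] int_adjoin_of_int[of "numeral k" z]
  by simp_all

lemma int_adjoin_add [simp]:
  "x \<in> int_adjoin z \<Longrightarrow> y \<in> int_adjoin z \<Longrightarrow> x + y \<in> int_adjoin z"
  unfolding int_adjoin_def by (auto simp flip: int_eval_add)

lemma int_adjoin_mult [simp]:
  "x \<in> int_adjoin z \<Longrightarrow> y \<in> int_adjoin z \<Longrightarrow> x * y \<in> int_adjoin z"
  unfolding int_adjoin_def by (auto simp flip: int_eval_mult)

lemma int_adjoin_diff [simp]:
  "x \<in> int_adjoin z \<Longrightarrow> y \<in> int_adjoin z \<Longrightarrow> x - y \<in> int_adjoin z"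
  unfolding int_adjoin_def by (auto simp flip: int_eval_diff)

lemma int_adjoin_uminus [simp]: "x \<in> int_adjoin z \<Longrightarrow> - x \<in> int_adjoin z"
  using int_adjoin_diff[of 0 z x] by simp

lemma int_adjoin_power [simp]: "x \<in> int_adjoin z \<Longrightarrow> x ^ n \<in> int_adjoin z"
  by (induction n) simp_all

lemma int_adjoin_sum [simp]:
  "(\<And>i. i \<in> A \<Longrightarrow> f i \<in> int_adjoin z) \<Longrightarrow> sum f A \<in> int_adjoin z"
  by (induction A rule: infinite_finite_induct) simp_all

section \<open>Which integers can be invertible in Z[z] for an algebraic integer z\<close>

text \<open>By Gauss's lemma, a primitive integer polynomial of least degree vanishing at \<open>z\<close>
  divides every other one over the integers.\<close>

lemma integral_minimal_polynomial:
  fixes z :: "'a::field_char_0"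
  assumes "q \<noteq> 0" "int_eval z q = 0"
  obtains f where "f \<noteq> 0" "int_eval z f = 0" "\<And>p. int_eval z p = 0 \<Longrightarrow> f dvd p"
proof -
  define V where "V p \<longleftrightarrow> p \<noteq> 0 \<and> int_eval z p = 0" for p
  obtain h where h: "V h" and min: "\<And>p. V p \<Longrightarrow> degree h \<le> degree p"
    using ex_has_least_nat[of V q degree] assms by (auto simp: V_def)
  define f where "f = primitive_part h"
  have h0: "h \<noteq> 0" "int_eval z h = 0" using h by (auto simp: V_def)
  have f0: "f \<noteq> 0" using h0 by (simp add: f_def)
  have cf: "content f = 1" using h0 by (simp add: f_def)
  have "of_int (content h) * int_eval z f = 0"
    using h0 int_eval_smult[of z "content h" f] by (simp add: f_def)
  then have fz: "int_eval z f = 0" using h0 by simp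
  have "f dvd p" if p: "int_eval z p = 0" for p
  proof -
    obtain a k where ak: "a \<noteq> 0" "smult a p = f * k + pseudo_mod p f"
      using pseudo_mod(1)[OF f0, of p] by blast
    have "int_eval z (smult a p) = int_eval z (f * k + pseudo_mod p f)"
      by (simp only: ak)
    then have "int_eval z (pseudo_mod p f) = 0"
      by (simp add: int_eval_smult int_eval_add int_eval_mult p fz)
    moreover have "pseudo_mod p f = 0 \<or> degree (pseudo_mod p f) < degree f"
      using pseudo_mod(2)[OF f0] .
    ultimately have "pseudo_mod p f = 0"
      using min[of "pseudo_mod p f"] unfolding V_def f_def by (metis degree_primitive_part not_less)
    then have "fract_poly (smult a p) = fract_poly (f * k)" using ak by simp
    then have "smult (to_fract a) (fract_poly p) = fract_poly f * fract_poly k"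
      by simp
    then have "fract_poly f dvd smult (to_fract a) (fract_poly p)" by simp
    \<comment> \<open>The factor \<open>a\<close> introduced by pseudo-division is invertible over
      the fraction field; primitivity of \<open>f\<close> then brings divisibility back to integer
      coefficients.\<close>
    then have "fract_poly f dvd fract_poly p"
      using ak(1) by (simp add: dvd_smult_iff)
    then show "f dvd p" using cf by (rule fract_poly_dvdD)
  qed
  with f0 fz that show ?thesis by blast
qed

text \<open>The minimal integer polynomial \<open>f\<close> divides the monic \<open>q\<close>, so
  its leading coefficient is a unit and the inverse \<open>d\<close> of \<open>p\<close> equals, up
  to a unit, the value R(z) of a remainder modulo \<open>f\<close>. Then p R - a vanishes at
  \<open>z\<close> and has smaller degree than \<open>f\<close>, so it is zero and \<open>p\<close>
  divides the unit \<open>a\<close>.\<close>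

lemma inverse_int_notin_adjoin_algebraic_int:
  fixes z :: "'a::field_char_0"
  assumes z: "lead_coeff q = 1" "int_eval z q = 0"
    and d: "d \<in> int_adjoin z" "of_int p * d = 1"
  shows "is_unit p"
proof -
  obtain f where f: "f \<noteq> 0" "int_eval z f = 0" "\<And>r. int_eval z r = 0 \<Longrightarrow> f dvd r"
    using integral_minimal_polynomial[of q z] z by (metis leading_coeff_0_iff one_neq_zero)
  have "lead_coeff f dvd lead_coeff q"
    using f(3)[OF z(2)] by (auto simp: lead_coeff_mult elim!: dvdE)
  then have uf: "is_unit (lead_coeff f)" using z by simp
  obtain D where D: "d = int_eval z D" using d(1) by (auto simp: int_adjoin_def)
  define R where "R = snd (pseudo_divmod D f)"
  define Q where "Q = fst (pseudo_divmod D f)"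
  define a where "a = lead_coeff f ^ (Suc (degree D) - degree f)"
  have R: "smult a D = f * Q + R" "R = 0 \<or> degree R < degree f"
    using pseudo_divmod[OF f(1), of D Q R] by (auto simp: R_def Q_def a_def)
  \<comment> \<open>Positive degree of \<open>f\<close> puts the constant \<open>[:a:]\<close>
    strictly below it.\<close>
  have "degree f \<noteq> 0"
  proof
    assume "degree f = 0"
    then obtain c where "f = [:c:]" by (rule degree_eq_zeroE)
    with f show False by simp
  qed
  have "int_eval z (smult a D) = int_eval z (f * Q + R)" by (simp only: R)
  then have "int_eval z R = of_int a * d"
    by (simp add: D f int_eval_smult int_eval_add int_eval_mult)
  then have "int_eval z (smult p R - [:a:]) = 0"
    using d(2) by (simp add: int_eval_diff int_eval_smult mult.left_commute[of "of_int p"])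
  then have "f dvd smult p R - [:a:]" by (rule f(3))
  moreover have "degree (smult p R - [:a:]) < degree f"
    using R(2) \<open>degree f \<noteq> 0\<close> by (intro degree_diff_less) (auto intro: le_less_trans[OF degree_smult_le])
  ultimately have "smult p R = [:a:]"
    by (metis dvd_imp_degree_le eq_iff_diff_eq_0 not_less)
  then have "p * coeff R 0 = a" by (metis coeff_pCons_0 coeff_smult)
  moreover have "is_unit a" unfolding a_def using uf by (rule is_unit_power_iff[THEN iffD2, OF disjI1])
  ultimately show ?thesis by (metis dvd_mult_left)
qed

section \<open>Congruences and units modulo an integer in Z[z]\<close>

text \<open>The cofactor must lie in the ring: in the ambient field, every difference is a multiple
  of a nonzero \<open>p\<close>.\<close>

definition cong_adjoin :: "'a::field_char_0 \<Rightarrow> int \<Rightarrow> 'a \<Rightarrow> 'a \<Rightarrow> bool" where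
  "cong_adjoin z p x y \<longleftrightarrow> (\<exists>d\<in>int_adjoin z. x = y + of_int p * d)"

lemma cong_adjoin_refl [simp]: "cong_adjoin z p x x"
  unfolding cong_adjoin_def by (rule bexI[of _ 0]) simp_all

lemma cong_adjoin_sym: "cong_adjoin z p x y \<Longrightarrow> cong_adjoin z p y x"
proof -
  assume "cong_adjoin z p x y"
  then obtain d where "d \<in> int_adjoin z" "x = y + of_int p * d" by (auto simp: cong_adjoin_def)
  then show ?thesis unfolding cong_adjoin_def by (intro bexI[of _ "- d"]) simp_all
qed

lemma cong_adjoin_add:
  assumes "cong_adjoin z p x y" "cong_adjoin z p x' y'"
  shows "cong_adjoin z p (x + x') (y + y')"
proof -
  obtain d d' where "d \<in> int_adjoin z" "x = y + of_int p * d"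
      "d' \<in> int_adjoin z" "x' = y' + of_int p * d'"
    using assms by (auto simp: cong_adjoin_def)
  then show ?thesis
    unfolding cong_adjoin_def by (intro bexI[of _ "d + d'"]) (simp_all add: algebra_simps)
qed

lemma cong_adjoin_trans:
  assumes "cong_adjoin z p x y" "cong_adjoin z p y w"
  shows "cong_adjoin z p x w"
proof -
  obtain d d' where "d \<in> int_adjoin z" "x = y + of_int p * d"
      "d' \<in> int_adjoin z" "y = w + of_int p * d'"
    using assms by (auto simp: cong_adjoin_def)
  then show ?thesis
    unfolding cong_adjoin_def by (intro bexI[of _ "d + d'"]) (simp_all add: algebra_simps)
qed

lemma cong_adjoin_mult_left:
  assumes "cong_adjoin z p x y" "c \<in> int_adjoin z"
  shows "cong_adjoin z p (c * x) (c * y)"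
proof -
  obtain d where "d \<in> int_adjoin z" "x = y + of_int p * d"
    using assms by (auto simp: cong_adjoin_def)
  then show ?thesis
    using assms unfolding cong_adjoin_def
    by (intro bexI[of _ "c * d"]) (simp_all add: algebra_simps)
qed

lemma cong_adjoin_mult_right:
  assumes "cong_adjoin z p x y" "c \<in> int_adjoin z"
  shows "cong_adjoin z p (x * c) (y * c)"
  using cong_adjoin_mult_left[OF assms] by (simp add: mult.commute)

lemma cong_adjoin_of_int: "[a = b] (mod p) \<Longrightarrow> cong_adjoin z p (of_int a) (of_int b)"
proof -
  assume "[a = b] (mod p)"
  then obtain k where "a = b + p * k" by (metis cong_iff_lin cong_sym)
  then show ?thesis unfolding cong_adjoin_def by (intro bexI[of _ "of_int k"]) simp_all
qed

lemma cong_adjoin_sum: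
  "(\<And>i. i \<in> A \<Longrightarrow> cong_adjoin z p (f i) (h i)) \<Longrightarrow> cong_adjoin z p (sum f A) (sum h A)"
  by (induction A rule: infinite_finite_induct) (simp_all add: cong_adjoin_add)

definition unit_mod :: "'a::field_char_0 \<Rightarrow> int \<Rightarrow> 'a \<Rightarrow> bool" where
  "unit_mod z p u \<longleftrightarrow> u \<in> int_adjoin z \<and> (\<exists>v\<in>int_adjoin z. cong_adjoin z p (u * v) 1)"

lemma unit_mod_1 [simp]: "unit_mod z p 1"
  unfolding unit_mod_def by (auto intro!: bexI[of _ 1])

lemma unit_mod_mult:
  assumes "unit_mod z p u" "unit_mod z p u'"
  shows "unit_mod z p (u * u')"
proof -
  obtain v v' where v: "v \<in> int_adjoin z" "cong_adjoin z p (u * v) 1"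
      "v' \<in> int_adjoin z" "cong_adjoin z p (u' * v') 1" "u \<in> int_adjoin z" "u' \<in> int_adjoin z"
    using assms by (auto simp: unit_mod_def)
  have "cong_adjoin z p ((u * v) * (u' * v')) (1 * (u' * v'))"
    using v by (intro cong_adjoin_mult_right) simp_all
  then have "cong_adjoin z p ((u * u') * (v * v')) 1"
    using cong_adjoin_trans[OF _ v(4)] by (simp add: mult_ac)
  then show ?thesis unfolding unit_mod_def using v by (intro conjI bexI[of _ "v * v'"]) simp_all
qed

lemma unit_mod_power: "unit_mod z p u \<Longrightarrow> unit_mod z p (u ^ n)"
  by (induction n) (simp_all add: unit_mod_mult)

lemma unit_mod_cong:
  assumes "cong_adjoin z p u u'" "unit_mod z p u" "u' \<in> int_adjoin z"
  shows "unit_mod z p u'"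
  using assms unfolding unit_mod_def
  by (meson cong_adjoin_mult_right cong_adjoin_sym cong_adjoin_trans)

lemma unit_mod_of_int:
  assumes "coprime c p"
  shows "unit_mod z p (of_int c)"
proof -
  obtain b where "[c * b = 1] (mod p)" using assms by (metis cong_solve_coprime_int)
  then have "cong_adjoin z p (of_int (c * b)) (of_int 1)" by (rule cong_adjoin_of_int)
  then show ?thesis unfolding unit_mod_def by (intro conjI bexI[of _ "of_int b"]) simp_all
qed

lemma unit_mod_factor:
  assumes "unit_mod z p (u * t)" "u \<in> int_adjoin z" "t \<in> int_adjoin z"
  shows "unit_mod z p u"
proof -
  obtain v where "v \<in> int_adjoin z" "cong_adjoin z p (u * t * v) 1"
    using assms by (auto simp: unit_mod_def)
  then show ?thesis
    unfolding unit_mod_def using assms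
    by (intro conjI bexI[of _ "t * v"]) (simp_all add: mult.assoc)
qed

text \<open>If 0 were a unit, the quotient Z[z]/p would be trivial and \<open>p\<close> would have
  an inverse in Z[z], which is impossible for an algebraic integer \<open>z\<close>.\<close>

lemma not_unit_mod_0:
  assumes "lead_coeff q = 1" "int_eval z q = 0" "\<not> is_unit p"
  shows "\<not> unit_mod z p 0"
proof
  assume "unit_mod z p 0"
  then obtain d where d: "d \<in> int_adjoin z" "0 = 1 + of_int p * d"
    by (auto simp: unit_mod_def cong_adjoin_def)
  then have "of_int p * (- d) = 1" by (metis add.inverse_inverse minus_unique mult_minus_right)
  with inverse_int_notin_adjoin_algebraic_int[OF assms(1,2) int_adjoin_uminus[OF d(1)]] assms(3)
  show False by blast
qed

section \<open>Falling factorials and the recursion for n! P_n(z)\<close>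

text \<open>Subtraction in the integers is not truncated, so modulo p each factor depends only on
  the residue of \<open>n\<close>.\<close>

definition falling :: "nat \<Rightarrow> nat \<Rightarrow> int" where
  "falling n k = (\<Prod>i<k. int n - int i)"

lemma fact_eq_falling_mult: "k \<le> n \<Longrightarrow> fact n = falling n k * fact (n - k)"
proof (induction k)
  case (Suc k)
  have "(fact (n - k) :: int) = (int n - int k) * fact (n - Suc k)"
    using Suc.prems fact_reduce[of "n - k", where 'a = int] by (simp add: of_nat_diff)
  then show ?case using Suc by (simp add: falling_def mult.assoc)
qed (simp add: falling_def)

lemma falling_cong: "[falling (p * l + r) k = falling r k] (mod int p)"
  unfolding falling_def by (rule cong_prod) (simp add: cong_iff_dvd_diff)

text \<open>The factor with index i = r is present, and it equals p l.\<close>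

lemma falling_cong_0:
  assumes "r < k"
  shows "[falling (p * l + r) k = 0] (mod int p)"
proof -
  have "int (p * l + r) - int r dvd falling (p * l + r) k"
    unfolding falling_def using assms by (intro dvd_prodI) auto
  then show ?thesis
    by (simp add: cong_0_iff) (metis dvd_mult_left)
qed

definition scaled_value :: "(nat \<Rightarrow> int) \<Rightarrow> 'a::field_char_0 \<Rightarrow> nat \<Rightarrow> 'a" where
  "scaled_value g z n = fact n * poly (P_poly g n) z"

lemma scaled_value_0 [simp]: "scaled_value g z 0 = 1"
  by (simp add: scaled_value_def)

text \<open>In the recursion for P_(n+1) multiplied by (n+1)!, one factor n + 1 cancels and
  n!/(n-k)! = \<open>falling n k\<close> remains, so all coefficients are integers. The summation
  index is shifted to start at 0, whence \<open>g (Suc k)\<close>.\<close>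

lemma scaled_value_Suc:
  "scaled_value g z (Suc n) =
     z * (\<Sum>k\<le>n. of_int (g (Suc k) * falling n k) * scaled_value g z (n - k))"
proof -
  have "(fact (Suc n) :: 'a) * (1 / of_nat (Suc n)) = fact n"
    by (simp del: of_nat_Suc)
  moreover have "scaled_value g z (Suc n) = fact (Suc n) * (1 / of_nat (Suc n)) *
      (z * (\<Sum>k=1..Suc n. of_int (g k) * poly (P_poly g (Suc n - k)) z))"
    by (simp add: scaled_value_def poly_sum del: sum.cl_ivl_Suc fact_Suc of_nat_Suc)
  ultimately have "scaled_value g z (Suc n) =
      z * (\<Sum>k=1..Suc n. fact n * (of_int (g k) * poly (P_poly g (Suc n - k)) z))"
    by (simp only: sum_distrib_left mult.left_commute)
  also have "(\<Sum>k=1..Suc n. fact n * (of_int (g k) * poly (P_poly g (Suc n - k)) z)) =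
      (\<Sum>k\<le>n. fact n * (of_int (g (Suc k)) * poly (P_poly g (n - k)) z))"
    by (rule sum.reindex_bij_witness[of _ Suc "\<lambda>k. k - 1"]) auto
  also have "\<dots> = (\<Sum>k\<le>n. of_int (g (Suc k) * falling n k) * scaled_value g z (n - k))"
  proof (rule sum.cong[OF refl])
    fix k assume "k \<in> {..n}"
    then have "of_int (fact n) = (of_int (falling n k * fact (n - k)) :: 'a)"
      by (simp only: fact_eq_falling_mult atMost_iff)
    then have "fact n = of_int (falling n k) * (fact (n - k) :: 'a)" by simp
    then show "fact n * (of_int (g (Suc k)) * poly (P_poly g (n - k)) z) =
        of_int (g (Suc k) * falling n k) * scaled_value g z (n - k)"
      by (simp add: scaled_value_def)
  qed
  finally show ?thesis .
qed

lemma scaled_value_in_adjoin [simp]: "scaled_value g z n \<in> int_adjoin z"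
proof (induction n rule: less_induct)
  case (less n)
  show ?case
  proof (cases n)
    case (Suc j)
    then have "scaled_value g z (j - i) \<in> int_adjoin z" for i by (intro less) simp
    then show ?thesis unfolding Suc scaled_value_Suc
      by (intro int_adjoin_mult int_adjoin_sum) simp_all
  qed simp
qed

section \<open>Multiplicativity modulo p and reduction to indices up to p\<close>

text \<open>In the recursion for index \<open>p l + r + 1\<close> the falling factorials vanish modulo \<open>p\<close> beyond
  \<open>k = r\<close>, so it becomes the recursion for index \<open>r + 1\<close>.\<close>

lemma scaled_value_add_cong:
  "r \<le> p \<Longrightarrow> cong_adjoin z (int p) (scaled_value g z (p * l + r))
     (scaled_value g z (p * l) * scaled_value g z r)"
proof (induction r rule: less_induct)
  case (less r)
  show ?case
  proof (cases r)
    case (Suc s)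
    let ?a = "scaled_value g z" and ?n = "p * l + s"
    let ?t = "\<lambda>k. of_int (g (Suc k) * falling ?n k) * ?a (?n - k)"
    have "cong_adjoin z (int p) (\<Sum>k\<le>?n. ?t k)
        (\<Sum>k\<le>?n. if k \<le> s then of_int (g (Suc k) * falling s k) * (?a (p * l) * ?a (s - k)) else 0)"
    proof (rule cong_adjoin_sum)
      fix k assume "k \<in> {..?n}"
      show "cong_adjoin z (int p) (?t k)
         (if k \<le> s then of_int (g (Suc k) * falling s k) * (?a (p * l) * ?a (s - k)) else 0)"
      proof (cases "k \<le> s")
        case True
        have "cong_adjoin z (int p) (?t k) (of_int (g (Suc k) * falling s k) * ?a (?n - k))"
          by (intro cong_adjoin_mult_right cong_adjoin_of_int cong_mult falling_cong) simp_all
        moreover have "cong_adjoin z (int p) (?a (p * l + (s - k))) (?a (p * l) * ?a (s - k))"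
          using less.prems Suc by (intro less.IH) auto
        then have "cong_adjoin z (int p) (of_int (g (Suc k) * falling s k) * ?a (?n - k))
            (of_int (g (Suc k) * falling s k) * (?a (p * l) * ?a (s - k)))"
          using True by (intro cong_adjoin_mult_left) simp_all
        ultimately show ?thesis using True cong_adjoin_trans by auto
      next
        case False
        then have "[g (Suc k) * falling ?n k = g (Suc k) * 0] (mod int p)"
          by (intro cong_mult falling_cong_0) simp_all
        then have "cong_adjoin z (int p) (?t k) (of_int (g (Suc k) * 0) * ?a (?n - k))"
          by (intro cong_adjoin_mult_right cong_adjoin_of_int) simp_all
        with False show ?thesis by simp
      qed
    qed
    also have "(\<Sum>k\<le>?n. if k \<le> s then of_int (g (Suc k) * falling s k) * (?a (p * l) * ?a (s - k)) else 0)
        = (\<Sum>k\<le>s. of_int (g (Suc k) * falling s k) * (?a (p * l) * ?a (s - k)))"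
      by (intro sum.mono_neutral_cong_right) auto
    also have "\<dots> = ?a (p * l) * (\<Sum>k\<le>s. of_int (g (Suc k) * falling s k) * ?a (s - k))"
      by (simp add: sum_distrib_left mult_ac)
    finally have "cong_adjoin z (int p) (z * (\<Sum>k\<le>?n. ?t k))
        (z * (?a (p * l) * (\<Sum>k\<le>s. of_int (g (Suc k) * falling s k) * ?a (s - k))))"
      by (rule cong_adjoin_mult_left) simp
    then show ?thesis
      unfolding Suc add_Suc_right scaled_value_Suc[of g z ?n] scaled_value_Suc[of g z s]
      by (simp only: mult.left_commute)
  qed simp
qed

text \<open>Induction on \<open>l\<close>: the boundary case r = p of
  \<open>scaled_value_add_cong\<close> contributes one factor \<open>scaled_value g z p\<close> per
  step.\<close>

lemma scaled_value_mult_cong: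
  "cong_adjoin z (int p) (scaled_value g z (p * l)) (scaled_value g z p ^ l)"
proof (induction l)
  case (Suc l)
  have "cong_adjoin z (int p) (scaled_value g z (p * l + p)) (scaled_value g z (p * l) * scaled_value g z p)"
    by (rule scaled_value_add_cong) simp
  moreover have "cong_adjoin z (int p) (scaled_value g z (p * l) * scaled_value g z p)
      (scaled_value g z p ^ l * scaled_value g z p)"
    using Suc by (rule cong_adjoin_mult_right) simp
  ultimately have "cong_adjoin z (int p) (scaled_value g z (p * l + p))
      (scaled_value g z p ^ l * scaled_value g z p)"
    by (rule cong_adjoin_trans)
  then show ?case by (simp add: add.commute mult.commute)
qed simp

lemma unit_mod_scaled_value:
  assumes "p > 0" "\<And>r. r \<le> p \<Longrightarrow> unit_mod z (int p) (scaled_value g z r)"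
  shows "unit_mod z (int p) (scaled_value g z n)"
proof -
  let ?a = "scaled_value g z" and ?l = "n div p" and ?r = "n mod p"
  have r: "?r \<le> p" using assms(1) by (simp add: less_imp_le)
  have "unit_mod z (int p) (?a (p * ?l))"
    using assms(2)[of p] by (intro unit_mod_cong[OF cong_adjoin_sym[OF scaled_value_mult_cong]] unit_mod_power) simp_all
  then have "unit_mod z (int p) (?a (p * ?l) * ?a ?r)"
    using assms(2)[OF r] by (rule unit_mod_mult)
  then have "unit_mod z (int p) (?a (p * ?l + ?r))"
    by (intro unit_mod_cong[OF cong_adjoin_sym[OF scaled_value_add_cong[OF r]]]) simp_all
  then show ?thesis by simp
qed

lemma scaled_value_small:
  assumes "g 1 = 1"
  shows "scaled_value g z 1 = z"
    and "scaled_value g z 2 = z * (z + of_int (g 2))"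
    and "scaled_value g z 3 = z * (z\<^sup>2 + 3 * of_int (g 2) * z + 2 * of_int (g 3))"
proof -
  show 1: "scaled_value g z 1 = z"
    using assms scaled_value_Suc[of g z 0] by (simp add: falling_def)
  show 2: "scaled_value g z 2 = z * (z + of_int (g 2))"
    using assms 1 scaled_value_Suc[of g z 1] by (simp add: falling_def numeral_2_eq_2)
  show "scaled_value g z 3 = z * (z\<^sup>2 + 3 * of_int (g 2) * z + 2 * of_int (g 3))"
    using assms 1 2 scaled_value_Suc[of g z 2]
    by (simp add: falling_def numeral_2_eq_2 numeral_3_eq_3 algebra_simps)
qed

section \<open>Units arising from roots of unity\<close>

text \<open>The inverse is z^(m-1).\<close>

lemma unit_mod_root_of_unity: "m > 0 \<Longrightarrow> z ^ m = 1 \<Longrightarrow> unit_mod z p z"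
  by (rule unit_mod_factor[of z p z "z ^ (m - 1)"]) (simp_all flip: power_Suc)

text \<open>By the geometric sum, 1 - x divides 1 - x^k, and a divisor of a unit is a unit.\<close>

lemma unit_mod_one_diff:
  assumes "unit_mod z p (1 - x ^ k)" "x \<in> int_adjoin z"
  shows "unit_mod z p (1 - x)"
  using assms by (intro unit_mod_factor[of z p "1 - x" "\<Sum>i<k. x ^ i"]) (simp_all add: one_diff_power_eq)

lemma unit_mod_uminus: "unit_mod z p x \<Longrightarrow> unit_mod z p (- x)"
  using unit_mod_mult[OF unit_mod_of_int[of "- 1" p z]] by simp

text \<open>Since \<open>1 + w + \<dots> + w ^ (s - 1) = 0\<close> and each \<open>w ^ i\<close> is congruent to 1 modulo \<open>1 - w\<close>,
  the element \<open>1 - w\<close> divides \<open>s\<close>.\<close>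

lemma unit_mod_one_diff_root_of_unity:
  assumes "w \<in> int_adjoin z" "w ^ s = 1" "w \<noteq> 1" "coprime (int s) p"
  shows "unit_mod z p (1 - w)"
proof -
  have "(\<Sum>i<s. w ^ i) = 0" using assms by (simp add: geometric_sum)
  then have "of_nat s = (\<Sum>i<s. 1 - w ^ i)" by (simp add: sum_subtractf)
  also have "\<dots> = (1 - w) * (\<Sum>i<s. \<Sum>j<i. w ^ j)"
    by (simp add: one_diff_power_eq sum_distrib_left)
  finally have "of_int (int s) = (1 - w) * (\<Sum>i<s. \<Sum>j<i. w ^ j)" by simp
  with unit_mod_of_int[OF assms(4), of z] assms(1)
  show ?thesis by (intro unit_mod_factor[of z p "1 - w" "\<Sum>i<s. \<Sum>j<i. w ^ j"]) simp_all
qed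

section \<open>Initial values modulo 2 and modulo 3\<close>

text \<open>Modulo 2 the factor z + g(2) is z or -(1 - z), according to the parity of g(2).\<close>

lemma unit_mod_2_scaled_value:
  assumes g: "g 1 = 1" and z: "unit_mod z 2 z" "unit_mod z 2 (1 - z)"
  shows "unit_mod z 2 (scaled_value g z n)"
proof -
  have u: "unit_mod z 2 (z + of_int (g 2))"
  proof (cases "even (g 2)")
    case True
    then have "cong_adjoin z 2 (of_int 0) (of_int (g 2))"
      by (intro cong_adjoin_of_int) (simp add: cong_iff_dvd_diff)
    then have "cong_adjoin z 2 (z + of_int 0) (z + of_int (g 2))"
      by (intro cong_adjoin_add) simp_all
    then show ?thesis using z(1) unit_mod_cong[of z 2 z] by simp
  next
    case False
    then have "cong_adjoin z 2 (of_int (- 1)) (of_int (g 2))"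
      by (intro cong_adjoin_of_int) (simp add: cong_iff_dvd_diff)
    then have "cong_adjoin z 2 (z + of_int (- 1)) (z + of_int (g 2))"
      by (intro cong_adjoin_add) simp_all
    then show ?thesis
      using unit_mod_uminus[OF z(2)] unit_mod_cong[of z 2 "z - 1"] by simp
  qed
  have "unit_mod z (int 2) (scaled_value g z n)"
  proof (rule unit_mod_scaled_value)
    fix r :: nat assume "r \<le> 2"
    then consider "r = 0" | "r = 1" | "r = 2" by linarith
    then show "unit_mod z (int 2) (scaled_value g z r)"
      by cases (use z u in \<open>simp_all add: scaled_value_small[of g, OF g, unfolded One_nat_def] unit_mod_mult\<close>)
  qed simp
  then show ?thesis by simp
qed

text \<open>Modulo 3 the factor z + g(2) is z, 1 + z or -(1 - z). The quadratic factor in the third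
  value reduces to z^2 - g(3), which is z^2 or -(1 - z)(1 + z). The excluded residue g(3) = 2 would
  give z^2 + 1, which vanishes at z = i.\<close>

lemma unit_mod_3_scaled_value:
  assumes g: "g 1 = 1" "[g 3 = 0] (mod 3) \<or> [g 3 = 1] (mod 3)"
    and z: "unit_mod z 3 z" "unit_mod z 3 (1 - z)" "unit_mod z 3 (1 + z)"
  shows "unit_mod z 3 (scaled_value g z n)"
proof -
  have "\<exists>c\<in>{0, 1, - 1}. [c = g 2] (mod 3)"
    unfolding cong_iff_dvd_diff by simp presburger
  then obtain c where c: "c \<in> {0, 1, - 1}" "[c = g 2] (mod 3)" by blast
  have "unit_mod z 3 (z + of_int c)"
    using c(1) z unit_mod_uminus[OF z(2)] by (auto simp: add.commute)
  moreover have "cong_adjoin z 3 (z + of_int c) (z + of_int (g 2))"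
    using c(2) by (intro cong_adjoin_add cong_adjoin_of_int) simp_all
  ultimately have u2: "unit_mod z 3 (z + of_int (g 2))"
    using unit_mod_cong by (metis int_adjoin_add int_adjoin_generator int_adjoin_of_int)
  have u3: "unit_mod z 3 (z\<^sup>2 + 3 * of_int (g 2) * z + 2 * of_int (g 3))"
  proof -
    obtain e where e: "e \<in> {0, 1}" "[g 3 = e] (mod 3)" using g(2) by blast
    have "z\<^sup>2 - 1 = - ((1 - z) * (1 + z))" by (simp add: algebra_simps power2_eq_square)
    then have "unit_mod z 3 (z\<^sup>2 - of_int e)"
      using e(1) unit_mod_uminus[OF unit_mod_mult[OF z(2,3)]] unit_mod_power[OF z(1), of 2] by auto
    moreover have "cong_adjoin z 3 (z\<^sup>2 - of_int e) (z\<^sup>2 + 3 * of_int (g 2) * z + 2 * of_int (g 3))"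
    proof -
      obtain k where "g 3 = e + 3 * k" using e(2) by (metis cong_iff_lin cong_sym)
      then show ?thesis unfolding cong_adjoin_def
        \<comment> \<open>Comes from writing -e as 2 e - 3 e and 2 g(3) as 2 e + 6 k.\<close>
        by (intro bexI[of _ "- (of_int (g 2) * z + of_int e + 2 * of_int k)"])
          (simp_all add: algebra_simps)
    qed
    ultimately show ?thesis
      by (elim unit_mod_cong[rotated]) simp_all
  qed
  have "unit_mod z (int 3) (scaled_value g z n)"
  proof (rule unit_mod_scaled_value)
    fix r :: nat assume "r \<le> 3"
    then consider "r = 0" | "r = 1" | "r = 2" | "r = 3" by linarith
    then show "unit_mod z (int 3) (scaled_value g z r)"
      by cases (use z u2 u3 in \<open>simp_all add: scaled_value_small[of g, OF g(1), unfolded One_nat_def] unit_mod_mult\<close>)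
  qed simp
  then show ?thesis by simp
qed

section \<open>Choice of the prime according to the order m\<close>

lemma P_poly_root_of_unity_nonzero:
  fixes z :: "'a::field_char_0"
  assumes g: "g 1 = 1" "[g 3 = 0] (mod 3) \<or> [g 3 = 1] (mod 3)"
    and m: "m \<ge> 3" and prim: "primitive_root_of_unity m z"
  shows "poly (P_poly g n) z \<noteq> 0"
proof
  assume "poly (P_poly g n) z = 0"
  then have a0: "scaled_value g z n = 0" by (simp add: scaled_value_def)
  have zm: "m > 0" "z ^ m = 1" and zk: "\<And>k. 0 < k \<Longrightarrow> k < m \<Longrightarrow> z ^ k \<noteq> 1"
    using prim by (auto simp: primitive_root_of_unity_def)
  \<comment> \<open>The monic polynomial X^m - 1 witnesses that \<open>z\<close> is an algebraic
    integer.\<close>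
  have "lead_coeff (monom 1 m + [:- 1:] :: int poly) = 1"
    using zm(1) by (simp add: degree_add_eq_left degree_monom_eq coeff_pCons split: nat.split)
  moreover have "int_eval z (monom 1 m + [:- 1:]) = 0"
    using zm by (simp add: int_eval_add)
  ultimately have no: "\<not> unit_mod z p 0" if "\<not> is_unit p" for p
    using that by (rule not_unit_mod_0)
  have uz: "unit_mod z p z" for p using zm by (rule unit_mod_root_of_unity)
  obtain s where s: "m = 2 ^ multiplicity 2 m * s" "odd s"
    using multiplicity_decompose'[of m 2] zm(1) by auto
  define k where "k = multiplicity 2 m"
  show False
  proof (cases "s = 1")
    case False
    with s(2) have "s > 1" by (cases s) auto
    \<comment> \<open>The power w = z^(2^k) differs from 1 because 2^k < m, and its s-th power is 1
      with \<open>s\<close> odd. Hence 1 - w is a unit modulo 2, and so is its divisor 1 -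
      z.\<close>
    have "2 ^ k * 1 < 2 ^ k * s" using \<open>s > 1\<close> by (intro mult_strict_left_mono) simp_all
    then have "2 ^ k < m" using s(1) by (simp add: k_def)
    then have "z ^ 2 ^ k \<noteq> 1" by (intro zk) simp_all
    moreover have "(z ^ 2 ^ k) ^ s = 1"
      using zm(2) s(1) by (simp add: k_def flip: power_mult)
    ultimately have "unit_mod z 2 (1 - z ^ 2 ^ k)"
      using s(2) by (intro unit_mod_one_diff_root_of_unity) simp_all
    then have "unit_mod z 2 (1 - z)" by (rule unit_mod_one_diff) simp
    from unit_mod_2_scaled_value[of g, OF g(1) uz[of 2] this, of n] no[of 2] a0 show False by simp
  next
    case True
    define h where "h = m div 2"
    have mk: "m = 2 ^ k" using s(1) True by (simp add: k_def)
    \<comment> \<open>The bound m >= 3 rules out the orders 1 and 2, that is z = 1 and z = -1, where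
      1 - z or 1 + z is zero.\<close>
    have "k \<ge> 2"
    proof (rule ccontr)
      assume "\<not> k \<ge> 2"
      then have "k = 0 \<or> k = 1" by linarith
      with mk m show False by auto
    qed
    then obtain j where "k = Suc (Suc j)" by (metis add_2_eq_Suc le_Suc_ex)
    then have h: "m = h * 2" "even h" using mk by (simp_all add: h_def)
    have "(z ^ h)\<^sup>2 = 1" using zm h(1) by (simp flip: power_mult)
    moreover have "z ^ h \<noteq> 1" using zm h(1) by (intro zk) auto
    ultimately have zh: "z ^ h = - 1" by (simp add: power2_eq_1_iff)
    have u2: "unit_mod z 3 2" using unit_mod_of_int[of 2 3 z] by simp
    have "unit_mod z 3 (1 - z)" by (rule unit_mod_one_diff[of _ _ _ h]) (simp_all add: zh u2)
    \<comment> \<open>As \<open>h\<close> is even, (-z)^h = z^h = -1 too, so 1 + z also divides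
      2.\<close>
    moreover have "unit_mod z 3 (1 - - z)"
      by (rule unit_mod_one_diff[of _ _ _ h]) (simp_all add: zh u2 h)
    ultimately have "unit_mod z 3 (scaled_value g z n)"
      by (intro unit_mod_3_scaled_value g uz) simp_all
    with no[of 3] a0 show False by simp
  qed
qed

text \<open>The first four powers are z, -1, -z and 1; in characteristic 0, z = 1 or z = -1 would
  contradict z^2 = -1. Only the square enters, so i and -i are treated together.\<close>

lemma primitive_root_of_unity_4:
  assumes "z\<^sup>2 = (- 1 :: 'a::field_char_0)"
  shows "primitive_root_of_unity 4 z"
proof -
  have "z ^ 3 = - z" "z ^ 4 = 1"
    using assms by (simp_all add: power2_eq_square numeral_eq_Suc flip: mult.assoc)
  moreover have "z \<noteq> 1" "- z \<noteq> 1"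
    using assms by (auto simp: minus_equation_iff[of z])
  ultimately have "z ^ k \<noteq> 1" if "k = 1 \<or> k = 2 \<or> k = 3" for k
    using that assms by auto
  moreover have "k = 1 \<or> k = 2 \<or> k = 3" if "0 < k" "k < 4" for k :: nat
    using that by linarith
  ultimately show ?thesis using \<open>z ^ 4 = 1\<close> by (auto simp: primitive_root_of_unity_def)
qed

theorem theorem3:
  fixes g :: "nat \<Rightarrow> int"
  assumes "g 1 = 1"
    and "[g 3 = 0] (mod 3) \<or> [g 3 = 1] (mod 3)"
  shows "(\<forall>(m::nat) (\<zeta>::complex). m \<ge> 3 \<longrightarrow> primitive_root_of_unity m \<zeta> \<longrightarrow>
            (\<forall>n. poly (P_poly g n) \<zeta> \<noteq> 0)) \<and>
         (\<forall>n. poly (P_poly g n) \<i> \<noteq> 0 \<and> poly (P_poly g n) (- \<i>) \<noteq> 0)"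
proof -
  have "poly (P_poly g n) \<zeta> \<noteq> 0" if "m \<ge> 3" "primitive_root_of_unity m \<zeta>" for m n and \<zeta> :: complex
    using P_poly_root_of_unity_nonzero[OF assms that] .
  moreover have "primitive_root_of_unity 4 \<i>" "primitive_root_of_unity 4 (- \<i>)"
    by (intro primitive_root_of_unity_4; simp)+
  moreover have "(4::nat) \<ge> 3" by simp
  ultimately show ?thesis by blast
qed

end
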